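(* Let $\alpha>0$, $N>1$, and let $S=(\kappa_1,\dots,\kappa_N,u_1,\dots,u_N)$ be a state, with leading arm $\hat i^*=\arg\max_i u_i$. The following hold for QCARE with parameter $\alpha$. (1) For every $\delta>0$, $\hat Q(S)\le\hat Q(\kappa_1,\dots,\kappa_N,u_1,\dots,u_{\hat i^*}+\delta,\dots,u_N)$. (2) For every $\delta>0$ and every $j\ne\hat i^*$, $\hat Q(S)\le\hat Q(\kappa_1,\dots,\kappa_j+\delta,\dots,\kappa_N,u_1,\dots,u_N)$.
   Context: QCARE is the following randomized policy for the $N$-armed bandit problem. In a state $S=(\kappa,u)$, where $\kappa=(\kappa_1,\dots,\kappa_N)\in\mathbb Z_+^N$ records how many times each arm has been pulled and $u=(u_1,\dots,u_N)\in[0,1]^N$ the empirical mean rewards of the arms, it draws scores $\theta_i=u_i+\frac{\epsilon_i}{(\kappa_i+1)^\alpha}$, $i\in[N]=\{1,\dots,N\}$, with $\epsilon_1,\dots,\epsilon_N$ independent standard normal, and pulls the arm with the highest score. Define $$Q_i(\kappa,u)=\Pr\big(\theta_i\ge\theta_j\ \text{for all } j\big),$$ the probability of pulling arm $i$ in state $(\kappa,u)$. The leading arm of a state is $\hat i^*=\arg\max_i u_i$ (ties broken by a fixed rule depending only on $u$), and $\hat Q(\kappa,u)=Q_{\hat i^*}(\kappa,u)$ is the probability of pulling the leading arm. The formula for $Q_i$ is used for real $\kappa_i\ge0$ and real $u_i$, so that it makes sense at the perturbed states. *)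

theory Defs
  imports "HOL-Probability.Probability"
begin

text \<open>
  The arms are \<open>{1..N}\<close>. Vectors indexed by the arms are functions on \<open>nat\<close>, of which
  only the values on \<open>{1..N}\<close> matter.
\<close>

definition qcare_noise :: "nat \<Rightarrow> (nat \<Rightarrow> real) measure" where
  "qcare_noise N = (\<Pi>\<^sub>M i\<in>{1..N}. density lborel std_normal_density)"

definition qcare_score ::
    "real \<Rightarrow> (nat \<Rightarrow> real) \<Rightarrow> (nat \<Rightarrow> real) \<Rightarrow> (nat \<Rightarrow> real) \<Rightarrow> nat \<Rightarrow> real" where
  "qcare_score \<alpha> \<kappa> u \<epsilon> i = u i + \<epsilon> i / (\<kappa> i + 1) powr \<alpha>"

definition qcare_Q ::
    "real \<Rightarrow> nat \<Rightarrow> (nat \<Rightarrow> real) \<Rightarrow> (nat \<Rightarrow> real) \<Rightarrow> nat \<Rightarrow> real" where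
  "qcare_Q \<alpha> N \<kappa> u i =
     \<P>(\<epsilon> in qcare_noise N. \<forall>j\<in>{1..N}. qcare_score \<alpha> \<kappa> u \<epsilon> i \<ge> qcare_score \<alpha> \<kappa> u \<epsilon> j)"

text \<open>
  A rule selecting the leading arm: an arg max of \<open>u\<close> over the arms, with ties broken in
  some fixed way. Rewards are arbitrary reals, because increasing an
  empirical mean in \<open>[0,1]\<close> may leave that interval. The second conjunct says that the choice
  ignores the irrelevant values of \<open>u\<close> outside \<open>{1..N}\<close>.
\<close>

definition leading_rule :: "nat \<Rightarrow> ((nat \<Rightarrow> real) \<Rightarrow> nat) \<Rightarrow> bool" where
  "leading_rule N lead \<longleftrightarrow>
     (\<forall>u. is_arg_max u (\<lambda>i. i \<in> {1..N}) (lead u)) \<and>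
     (\<forall>u v. (\<forall>i\<in>{1..N}. u i = v i) \<longrightarrow> lead u = lead v)"

definition qcare_Q_lead ::
    "real \<Rightarrow> nat \<Rightarrow> ((nat \<Rightarrow> real) \<Rightarrow> nat) \<Rightarrow> (nat \<Rightarrow> real) \<Rightarrow> (nat \<Rightarrow> real) \<Rightarrow> real" where
  "qcare_Q_lead \<alpha> N lead \<kappa> u = qcare_Q \<alpha> N \<kappa> u (lead u)"

text \<open>
  Pull counts of an actual state are natural numbers; they are real-valued here only
  because the functions above are also evaluated at perturbed, non-integral counts.
\<close>

definition bandit_state :: "nat \<Rightarrow> (nat \<Rightarrow> real) \<Rightarrow> (nat \<Rightarrow> real) \<Rightarrow> bool" where
  "bandit_state N \<kappa> u \<longleftrightarrow> (\<forall>i\<in>{1..N}. \<kappa> i \<in> \<nat> \<and> u i \<in> {0..1})"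

end

theory Submission
  imports Defs
begin

text \<open>
  Conditioning on the noise of the leading arm \<open>l\<close> turns its selection probability into a single
  Gaussian integral of a product of values of the normal distribution function \<open>\<Phi>\<close>, one factor
  \<open>\<Phi> ((\<theta>\<^sub>l - u\<^sub>j) s\<^sub>j)\<close> per competitor, with \<open>s\<^sub>j = (\<kappa>\<^sub>j + 1)\<^sup>\<alpha>\<close>. Raising
  \<open>s\<^sub>j\<close> changes only the factor of \<open>j\<close>, by an amount that is odd in \<open>\<theta>\<^sub>l - u\<^sub>j\<close> and nonnegative
  for \<open>\<theta>\<^sub>l \<ge> u\<^sub>j\<close>. Pairing the points \<open>u\<^sub>j + t\<close> and \<open>u\<^sub>j - t\<close>, the gain outweighs the loss: the
  remaining factors increase in \<open>\<theta>\<^sub>l\<close>, and the density of \<open>\<theta>\<^sub>l\<close> at \<open>u\<^sub>j + t\<close> is at least the one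
  at \<open>u\<^sub>j - t\<close>, because its mean \<open>u\<^sub>l\<close> is at least \<open>u\<^sub>j\<close>.
\<close>

section \<open>Integrals under reflection about a point\<close>

lemma integral_nonneg_reflection:
  fixes h :: "real \<Rightarrow> real"
  assumes "\<And>t. 0 \<le> h (c + t) + h (c - t)"
  shows "0 \<le> (\<integral>x. h x \<partial>lborel)"
proof (cases "integrable lborel h")
  case True
  \<comment> \<open>Both substitutions \<open>x = c + t\<close> and \<open>x = c - t\<close>
    preserve Lebesgue measure, so the integral of the paired sum is twice that of
    \<open>h\<close>.\<close>
  have int: "integrable lborel (\<lambda>t. h (c + t))" "integrable lborel (\<lambda>t. h (c - t))"
    using lborel_integrable_real_affine[OF True, of 1 c]
      lborel_integrable_real_affine[OF True, of "-1" c] by simp_all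
  have "0 \<le> (\<integral>t. h (c + t) + h (c - t) \<partial>lborel)"
    using assms by (rule Bochner_Integration.integral_nonneg)
  also have "\<dots> = (\<integral>t. h (c + t) \<partial>lborel) + (\<integral>t. h (c - t) \<partial>lborel)"
    using int by simp
  also have "\<dots> = 2 * (\<integral>x. h x \<partial>lborel)"
    using lborel_integral_real_affine[of 1 h c] lborel_integral_real_affine[of "-1" h c] by simp
  finally show ?thesis by simp
\<comment> \<open>Without integrability the Bochner integral is 0 by convention.\<close>
qed (simp add: not_integrable_integral_eq)

section \<open>The standard normal distribution\<close>

abbreviation std_normal_cdf :: "real \<Rightarrow> real" ("\<Phi>") where
  "\<Phi> \<equiv> cdf std_normal_distribution"

interpretation std_normal: real_distribution std_normal_distribution
  by (rule real_dist_normal_dist)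

lemma std_normal_cdf_mono: "x \<le> y \<Longrightarrow> \<Phi> x \<le> \<Phi> y"
  by (rule std_normal.cdf_nondecreasing)

lemma borel_measurable_std_normal_cdf [measurable]: "\<Phi> \<in> borel_measurable borel"
  by (intro borel_measurable_mono monoI std_normal_cdf_mono)

lemma std_normal_cdf_minus: "\<Phi> (- x) = 1 - \<Phi> x"
proof -
  let ?N = std_normal_distribution
  have "emeasure ?N {..- x} = (\<integral>\<^sup>+y. ennreal (std_normal_density y) * indicator {..- x} y \<partial>lborel)"
    by (simp add: emeasure_density)
  also have "\<dots> = (\<integral>\<^sup>+y. ennreal (std_normal_density y) * indicator {x..} y \<partial>lborel)"
    \<comment> \<open>Substitute \<open>-y\<close> for \<open>y\<close>; the density is
      even.\<close>
    by (subst nn_integral_real_affine[where c = "-1" and t = 0])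
      (auto simp: normal_density_def intro!: nn_integral_cong split: split_indicator)
  \<comment> \<open>The endpoint is a null set; dropping it leaves the complement of
    \<open>{..x}\<close>.\<close>
  also have "\<dots> = (\<integral>\<^sup>+y. ennreal (std_normal_density y) * indicator {x<..} y \<partial>lborel)"
  proof (rule nn_integral_cong_AE)
    show "AE y in lborel. ennreal (std_normal_density y) * indicator {x..} y
        = ennreal (std_normal_density y) * indicator {x<..} y"
      using AE_lborel_singleton[of x] by eventually_elim (auto split: split_indicator)
  qed
  also have "\<dots> = emeasure ?N {x<..}"
    by (simp add: emeasure_density)
  finally have "measure ?N {..- x} = measure ?N {x<..}"
    by (simp add: measure_def)
  also have "{x<..} = space ?N - {..x}" by auto
  finally show ?thesis
    using std_normal.prob_compl[of "{..x}"] by (simp add: cdf_def)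
qed

text \<open>The density decreases with the distance from \<open>\<mu>\<close>, and
  \<open>c - t\<close> lies at least as far from \<open>\<mu>\<close> as
  \<open>c + t\<close>.\<close>

lemma normal_density_reflection:
  assumes "c \<le> \<mu>" and "0 \<le> t" and "0 < \<sigma>"
  shows "normal_density \<mu> \<sigma> (c - t) \<le> normal_density \<mu> \<sigma> (c + t)"
proof -
  have "\<bar>c + t - \<mu>\<bar> \<le> \<bar>c - t - \<mu>\<bar>" using assms by linarith
  then have "(c + t - \<mu>)\<^sup>2 \<le> (c - t - \<mu>)\<^sup>2" by (simp add: abs_le_square_iff)
  then show ?thesis
    using assms by (simp add: normal_density_def divide_right_mono)
qed

text \<open>The pairing argument in terms of the leading arm's noise \<open>x\<close>:
  \<open>c\<close> is the noise at which its score equals the mean of arm \<open>j\<close>,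
  \<open>a\<close> and \<open>b\<close> are the slopes before and after raising the count of
  \<open>j\<close>, and \<open>G\<close> collects the other competitors.\<close>

lemma std_normal_integral_mono_scale:
  fixes G :: "real \<Rightarrow> real"
  assumes G: "mono G" "\<And>x. G x \<in> {0..1}"
    and c: "c \<le> 0" and ab: "0 \<le> a" "a \<le> b"
  shows "(\<integral>x. \<Phi> ((x - c) * a) * G x \<partial>std_normal_distribution)
       \<le> (\<integral>x. \<Phi> ((x - c) * b) * G x \<partial>std_normal_distribution)"
proof -
  have [measurable]: "G \<in> borel_measurable borel"
    using G(1) by (rule borel_measurable_mono)
  have int: "integrable std_normal_distribution (\<lambda>x. \<Phi> ((x - c) * r) * G x)" for r
  proof (rule std_normal.integrable_const_bound[where B = 1])
    show "AE x in std_normal_distribution. norm (\<Phi> ((x - c) * r) * G x) \<le> 1"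
      using G(2) by (auto simp: abs_mult std_normal.cdf_nonneg std_normal.cdf_bounded_prob
          intro!: mult_le_one)
  qed simp
  define D where "D x = \<Phi> ((x - c) * b) - \<Phi> ((x - c) * a)" for x
  define H where "H x = std_normal_density x * G x" for x
  have [measurable]: "D \<in> borel_measurable borel" unfolding D_def by measurable
  \<comment> \<open>By \<open>std_normal_cdf_minus\<close> both terms of \<open>D\<close> turn into
    one minus their mirror values; the ones cancel.\<close>
  have D_refl: "D (c - t) = - D (c + t)" for t
    using std_normal_cdf_minus[of "t * a"] std_normal_cdf_minus[of "t * b"] by (simp add: D_def)
  have D_nonneg: "0 \<le> D (c + t)" if "0 \<le> t" for t
    using that ab by (simp add: D_def std_normal_cdf_mono mult_left_mono)
  have H_le: "H (c - t) \<le> H (c + t)" if "0 \<le> t" for t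
    unfolding H_def using that c G(2) monoD[OF G(1), of "c - t" "c + t"]
    by (intro mult_mono normal_density_reflection) auto
  have pair: "0 \<le> H (c + t) * D (c + t) + H (c - t) * D (c - t)" if "0 \<le> t" for t
    using mult_right_mono[OF H_le[OF that] D_nonneg[OF that]] by (simp add: D_refl)
  have "0 \<le> (\<integral>x. H x * D x \<partial>lborel)"
  proof (rule integral_nonneg_reflection[where c = c])
    \<comment> \<open>The paired sum is even in \<open>t\<close>, so negative \<open>t\<close>
      reduces to \<open>- t\<close>.\<close>
    show "0 \<le> H (c + t) * D (c + t) + H (c - t) * D (c - t)" for t
      using pair[of t] pair[of "- t"] by (cases "0 \<le> t") (simp_all add: add.commute)
  qed
  also have "\<dots> = (\<integral>x. G x * D x \<partial>std_normal_distribution)"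
    by (subst integral_density) (simp_all add: H_def mult.assoc)
  also have "\<dots> = (\<integral>x. \<Phi> ((x - c) * b) * G x
      - \<Phi> ((x - c) * a) * G x \<partial>std_normal_distribution)"
    by (simp add: D_def algebra_simps)
  finally show ?thesis
    using int by simp
qed

section \<open>The selection probability as a one-dimensional integral\<close>

lemma sets_qcare_event:
  assumes "i \<in> {1..N}"
  shows "{\<epsilon> \<in> space (qcare_noise N). \<forall>j\<in>{1..N}.
      qcare_score \<alpha> \<kappa> u \<epsilon> i \<ge> qcare_score \<alpha> \<kappa> u \<epsilon> j} \<in> sets (qcare_noise N)"
proof -
  have [measurable]: "(\<lambda>\<epsilon>. \<epsilon> j) \<in> borel_measurable (qcare_noise N)" if "j \<in> {1..N}" for j
    using measurable_component_singleton[OF that, of "\<lambda>_. std_normal_distribution"]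
    by (simp add: qcare_noise_def)
  have score: "(\<lambda>\<epsilon>. qcare_score \<alpha> \<kappa> u \<epsilon> j) \<in> borel_measurable (qcare_noise N)"
    if "j \<in> {1..N}" for j
    using that unfolding qcare_score_def by measurable
  show ?thesis
    using assms by (intro sets.sets_Collect_finite_All borel_measurable_le score) auto
qed

lemma qcare_Q_eq_integral:
  assumes l: "l \<in> {1..N}" and \<kappa>: "\<And>i. i \<in> {1..N} \<Longrightarrow> 0 \<le> \<kappa> i"
  shows "qcare_Q \<alpha> N \<kappa> u l =
    (\<integral>x. (\<Prod>k\<in>{1..N} - {l}. \<Phi> ((u l + x / (\<kappa> l + 1) powr \<alpha> - u k) * (\<kappa> k + 1) powr \<alpha>))
       \<partial>std_normal_distribution)"
proof -
  define I where "I = {1..N} - {l}"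
  define s where "s k = (\<kappa> k + 1) powr \<alpha>" for k
  define M where "M = (\<lambda>_ :: nat. std_normal_distribution)"
  define E where "E = {\<epsilon> \<in> space (qcare_noise N). \<forall>j\<in>{1..N}.
      qcare_score \<alpha> \<kappa> u \<epsilon> l \<ge> qcare_score \<alpha> \<kappa> u \<epsilon> j}"
  define P where "P x = (\<Prod>k\<in>I. \<Phi> ((u l + x / s l - u k) * s k))" for x
  interpret product_prob_space M "{1..N}"
    unfolding product_prob_space_def product_prob_space_axioms_def product_sigma_finite_def M_def
    using real_dist_normal_dist
    by (simp add: std_normal.prob_space_axioms prob_space_imp_sigma_finite)
  have s_pos: "0 < s k" if "k \<in> {1..N}" for k
    using \<kappa>[OF that] by (simp add: s_def)
  have I: "finite I" "l \<notin> I" "insert l I = {1..N}"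
    using l by (auto simp: I_def)
  have noise: "qcare_noise N = PiM (insert l I) M"
    by (simp add: qcare_noise_def M_def I)
  have E_sets: "E \<in> sets (PiM (insert l I) M)"
    using sets_qcare_event[OF l] unfolding E_def noise .
  \<comment> \<open>Once the noise of \<open>l\<close> is fixed to \<open>x\<close>, each competitor
    constrains only its own noise: since \<open>s k > 0\<close>, its inequality can be solved for
    \<open>\<epsilon> k\<close>. The slice is therefore a box, whose probability is a
    product.\<close>
  have slice: "indicator E (\<epsilon>(l := x)) =
      (indicator (Pi\<^sub>E I (\<lambda>k. {..(u l + x / s l - u k) * s k})) \<epsilon> :: ennreal)"
    if \<epsilon>: "\<epsilon> \<in> space (PiM I M)" for \<epsilon> x
  proof -
    have space: "\<epsilon>(l := x) \<in> space (qcare_noise N)"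
      using \<epsilon> unfolding noise by (auto simp: space_PiM M_def PiE_iff extensional_def)
    have "\<epsilon>(l := x) \<in> E \<longleftrightarrow> (\<forall>k\<in>I. \<epsilon> k \<le> (u l + x / s l - u k) * s k)"
    proof -
      have "qcare_score \<alpha> \<kappa> u (\<epsilon>(l := x)) k \<le> qcare_score \<alpha> \<kappa> u (\<epsilon>(l := x)) l \<longleftrightarrow>
          \<epsilon> k \<le> (u l + x / s l - u k) * s k" if "k \<in> I" for k
      proof -
        have "k \<noteq> l" "0 < s k" using that s_pos by (auto simp: I_def)
        then show ?thesis
          by (simp add: qcare_score_def s_def[symmetric] pos_divide_le_eq[symmetric])
            (simp add: algebra_simps)
      qed
      then show ?thesis
        using space unfolding E_def I(3)[symmetric] by auto
    qed
    then show ?thesis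
      using \<epsilon> by (auto simp: space_PiM PiE_iff split: split_indicator)
  qed
  have P_nonneg: "0 \<le> P x" for x
    unfolding P_def by (intro prod_nonneg) (simp add: std_normal.cdf_nonneg)
  have [measurable]: "P \<in> borel_measurable borel"
    unfolding P_def by measurable
  have "emeasure (qcare_noise N) E = (\<integral>\<^sup>+\<epsilon>. indicator E \<epsilon> \<partial>PiM (insert l I) M)"
    using E_sets unfolding noise by simp
  \<comment> \<open>Tonelli, with the noise of \<open>l\<close> as the outer variable.\<close>
  also have "\<dots> = (\<integral>\<^sup>+x. (\<integral>\<^sup>+\<epsilon>. indicator E (\<epsilon>(l := x)) \<partial>PiM I M) \<partial>M l)"
    using E_sets I by (intro product_nn_integral_insert_rev) auto
  also have "\<dots> = (\<integral>\<^sup>+x. ennreal (P x) \<partial>M l)"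
  proof (rule nn_integral_cong)
    fix x
    let ?A = "\<lambda>k. {..(u l + x / s l - u k) * s k}"
    have "(\<integral>\<^sup>+\<epsilon>. indicator E (\<epsilon>(l := x)) \<partial>PiM I M) = (\<integral>\<^sup>+\<epsilon>. indicator (Pi\<^sub>E I ?A) \<epsilon> \<partial>PiM I M)"
      by (intro nn_integral_cong slice)
    also have "\<dots> = emeasure (PiM I M) (Pi\<^sub>E I ?A)"
      using I by (intro nn_integral_indicator sets_PiM_I_finite) (auto simp: M_def)
    also have "\<dots> = (\<Prod>k\<in>I. emeasure (M k) (?A k))"
      using I by (intro emeasure_PiM) (auto simp: M_def)
    also have "\<dots> = ennreal (P x)"
      unfolding M_def P_def cdf_def std_normal.emeasure_eq_measure by (intro prod_ennreal) simp
    finally show "(\<integral>\<^sup>+\<epsilon>. indicator E (\<epsilon>(l := x)) \<partial>PiM I M) = ennreal (P x)" .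
  qed
  also have "\<dots> = (\<integral>\<^sup>+x. ennreal (P x) \<partial>std_normal_distribution)"
    by (simp add: M_def)
  finally have "measure (qcare_noise N) E = enn2real (\<integral>\<^sup>+x. ennreal (P x) \<partial>std_normal_distribution)"
    by (simp add: measure_def)
  also have "\<dots> = (\<integral>x. P x \<partial>std_normal_distribution)"
    using P_nonneg by (intro integral_eq_nn_integral[symmetric]) simp_all
  finally show ?thesis
    unfolding qcare_Q_def E_def P_def s_def I_def .
qed

section \<open>Monotonicity in an arm's own mean and in a competitor's count\<close>

lemma qcare_Q_mono_mean:
  assumes "i \<in> {1..N}" and "0 \<le> \<delta>"
  shows "qcare_Q \<alpha> N \<kappa> u i \<le> qcare_Q \<alpha> N \<kappa> (u(i := u i + \<delta>)) i"
proof -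
  interpret prob_space "qcare_noise N"
    unfolding qcare_noise_def by (intro prob_space_PiM std_normal.prob_space_axioms)
  \<comment> \<open>Compare the two states under the same noise: the score of \<open>i\<close> rises
    by \<open>\<delta>\<close> and the others stay, so the winning event can only grow.\<close>
  have "qcare_score \<alpha> \<kappa> (u(i := u i + \<delta>)) \<epsilon> j \<le> qcare_score \<alpha> \<kappa> (u(i := u i + \<delta>)) \<epsilon> i"
    if "qcare_score \<alpha> \<kappa> u \<epsilon> j \<le> qcare_score \<alpha> \<kappa> u \<epsilon> i" for \<epsilon> j
    using that assms(2) by (auto simp: qcare_score_def)
  then show ?thesis
    unfolding qcare_Q_def using sets_qcare_event[OF assms(1)]
    by (intro finite_measure_mono) auto
qed

lemma qcare_Q_mono_count:
  assumes l: "l \<in> {1..N}" and j: "j \<in> {1..N}" "j \<noteq> l" and u: "u j \<le> u l"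
    and \<kappa>: "\<And>i. i \<in> {1..N} \<Longrightarrow> 0 \<le> \<kappa> i" and \<alpha>: "0 \<le> \<alpha>" and \<delta>: "0 \<le> \<delta>"
  shows "qcare_Q \<alpha> N \<kappa> u l \<le> qcare_Q \<alpha> N (\<kappa>(j := \<kappa> j + \<delta>)) u l"
proof -
  define s where "s k = (\<kappa> k + 1) powr \<alpha>" for k
  define s' where "s' = (\<kappa> j + \<delta> + 1) powr \<alpha>"
  define I where "I = {1..N} - {l}"
  define G where "G x = (\<Prod>k\<in>I - {j}. \<Phi> ((u l + x / s l - u k) * s k))" for x
  \<comment> \<open>Chosen so that \<open>u l + c / s l = u j\<close>; thus \<open>c \<le> 0\<close>
    expresses that \<open>l\<close> leads \<open>j\<close>.\<close>
  define c where "c = (u j - u l) * s l"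
  have s_pos: "0 < s l" using \<kappa>[OF l] by (simp add: s_def)
  have G_mono: "mono G"
  proof (rule monoI)
    fix x y :: real assume "x \<le> y"
    then show "G x \<le> G y"
      unfolding G_def using s_pos
      by (intro prod_mono)
        (auto simp: std_normal.cdf_nonneg s_def
          intro!: std_normal_cdf_mono mult_right_mono divide_right_mono)
  qed
  have G_range: "G x \<in> {0..1}" for x
    unfolding G_def
    by (auto intro!: prod_nonneg prod_le_1 simp: std_normal.cdf_nonneg std_normal.cdf_bounded_prob)
  have I: "finite I" "j \<in> I" using j by (auto simp: I_def)
  have "c \<le> 0" using u s_pos by (simp add: c_def mult_nonpos_nonneg)
  have scale: "(u l + x / s l - u j) * r = (x - c) * (r / s l)" for x r
    using s_pos by (simp add: c_def field_simps)
  have "s j \<le> s'"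
    using \<alpha> \<delta> \<kappa>[OF j(1)] by (simp add: s_def s'_def powr_mono2)
  have Q: "qcare_Q \<alpha> N \<kappa> u l = (\<integral>x. \<Phi> ((x - c) * (s j / s l)) * G x \<partial>std_normal_distribution)"
    using qcare_Q_eq_integral[where \<kappa> = \<kappa> and \<alpha> = \<alpha> and u = u, OF l \<kappa>]
    unfolding s_def[symmetric] I_def[symmetric] prod.remove[OF I] scale
    by (simp add: G_def)
  \<comment> \<open>As \<open>j \<noteq> l\<close>, the update keeps \<open>s l\<close>,
    \<open>c\<close> and \<open>G\<close>; only the slope in the factor of \<open>j\<close>
    changes.\<close>
  have Q': "qcare_Q \<alpha> N (\<kappa>(j := \<kappa> j + \<delta>)) u l
      = (\<integral>x. \<Phi> ((x - c) * (s' / s l)) * G x \<partial>std_normal_distribution)"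
  proof -
    have nonneg: "0 \<le> (\<kappa>(j := \<kappa> j + \<delta>)) i" if "i \<in> {1..N}" for i
      using \<kappa>[OF that] \<kappa>[OF j(1)] \<delta> by simp
    show ?thesis
      using qcare_Q_eq_integral[where \<kappa> = "\<kappa>(j := \<kappa> j + \<delta>)" and \<alpha> = \<alpha> and u = u, OF l nonneg] j(2)
      unfolding I_def[symmetric] prod.remove[OF I]
      by (simp add: s_def[symmetric] s'_def[symmetric] scale G_def)
  qed
  show ?thesis
    unfolding Q Q'
  proof (rule std_normal_integral_mono_scale[OF G_mono G_range \<open>c \<le> 0\<close>])
    show "0 \<le> s j / s l" by (simp add: s_def)
    show "s j / s l \<le> s' / s l" using s_pos \<open>s j \<le> s'\<close> by (simp add: divide_right_mono)
  qed
qed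

section \<open>The leading arm and the conclusion\<close>

lemma leading_rule_in: "leading_rule N lead \<Longrightarrow> lead u \<in> {1..N}"
  by (auto simp: leading_rule_def is_arg_max_def)

lemma leading_rule_ge:
  "leading_rule N lead \<Longrightarrow> j \<in> {1..N} \<Longrightarrow> (u :: nat \<Rightarrow> real) j \<le> u (lead u)"
  by (auto simp: leading_rule_def is_arg_max_def not_less)

text \<open>The raised arm strictly beats every other, so no tie remains to be broken. Hence the
  leading probabilities before and after the increase concern the same arm.\<close>

lemma leading_rule_increase:
  assumes "leading_rule N lead" and "0 < \<delta>"
  shows "lead (u(lead u := u (lead u) + \<delta>)) = lead u"
proof (rule ccontr)
  let ?v = "u(lead u := u (lead u) + \<delta>)"
  assume "lead ?v \<noteq> lead u"
  moreover have "u (lead ?v) \<le> u (lead u)"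
    using assms(1) by (intro leading_rule_ge leading_rule_in)
  moreover have "?v (lead u) \<le> ?v (lead ?v)"
    using assms(1) by (intro leading_rule_ge leading_rule_in)
  ultimately show False
    using assms(2) by simp
qed

theorem proposition2:
  fixes \<alpha> :: real and N :: nat and \<kappa> u :: "nat \<Rightarrow> real"
    and lead :: "(nat \<Rightarrow> real) \<Rightarrow> nat"
  assumes "\<alpha> > 0" and "N > 1"
    and "leading_rule N lead"
    and "bandit_state N \<kappa> u"
  shows "(\<forall>\<delta>>0. qcare_Q_lead \<alpha> N lead \<kappa> u
                 \<le> qcare_Q_lead \<alpha> N lead \<kappa> (u(lead u := u (lead u) + \<delta>))) \<and>
         (\<forall>\<delta>>0. \<forall>j\<in>{1..N}. j \<noteq> lead u \<longrightarrow>
            qcare_Q_lead \<alpha> N lead \<kappa> u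
              \<le> qcare_Q_lead \<alpha> N lead (\<kappa>(j := \<kappa> j + \<delta>)) u)"
proof (intro conjI allI impI ballI)
  fix \<delta> :: real assume "\<delta> > 0"
  then show "qcare_Q_lead \<alpha> N lead \<kappa> u
      \<le> qcare_Q_lead \<alpha> N lead \<kappa> (u(lead u := u (lead u) + \<delta>))"
    unfolding qcare_Q_lead_def leading_rule_increase[OF assms(3) \<open>\<delta> > 0\<close>]
    by (intro qcare_Q_mono_mean leading_rule_in[OF assms(3)]) simp
next
  fix \<delta> :: real and j assume "\<delta> > 0" and j: "j \<in> {1..N}" "j \<noteq> lead u"
  have \<kappa>: "0 \<le> \<kappa> i" if "i \<in> {1..N}" for i
    using assms(4) that unfolding bandit_state_def by (metis Nats_cases of_nat_0_le_iff)
  show "qcare_Q_lead \<alpha> N lead \<kappa> u \<le> qcare_Q_lead \<alpha> N lead (\<kappa>(j := \<kappa> j + \<delta>)) u"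
    unfolding qcare_Q_lead_def
    using j \<kappa> assms(1) \<open>\<delta> > 0\<close> leading_rule_ge[OF assms(3) j(1)]
    by (intro qcare_Q_mono_count leading_rule_in[OF assms(3)]) auto
qed

end
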